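(* Let $G=(V,E)$ be a finite complete graph and let $$P=\Big\{x\in\mathbb{R}^{E} : \sum_{e\in E(G[U])}x(e)\le |U|-1\ \ \forall\,\emptyset\neq U\subseteq V,\quad x(e)\ge 0\ \ \forall e\in E\Big\}.$$ Then $P$ has circuit diameter at most $7$.
   Context: $G[U]$ is the subgraph of $G$ induced by $U$. Let $B$ be the inequality constraint matrix of the given description of $P$ (there are no equality constraints). The circuits of $P$ are the vectors $g\in\mathbb{R}^E\setminus\{0\}$, normalized to coprime integer components, for which the support of $Bg$ is inclusion-minimal among the supports of $\{Bx : x\in\mathbb{R}^E\setminus\{0\}\}$. A circuit walk of length $k$ in $P$ is a sequence $x_0,\ldots,x_k$ of points of $P$, with $x_0$ an extreme point, such that for each $i=0,\ldots,k-1$, $x_{i+1}=x_i+\epsilon_i g_i$ for some circuit $g_i$ and $\epsilon_i>0$, where $x_i+\epsilon g_i\notin P$ for all $\epsilon>\epsilon_i$. The circuit diameter of $P$ is the maximum, over all ordered pairs $(u,v)$ of extreme points of $P$, of the minimum length of a circuit walk from $u$ to $v$. *)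

theory Defs
  imports "HOL-Analysis.Analysis"
begin

text \<open>
  A finite simple graph is a vertex set \<open>V\<close> of a finite type together with a set \<open>E\<close> of
  two-element subsets of \<open>V\<close>.  The space \<open>\<real>\<^sup>E\<close> is the coordinate subspace of the vectors
  indexed by all vertex sets that vanish outside \<open>E\<close>; this allows \<open>E\<close> to be empty, which an
  index type for the edges would not.
\<close>

definition complete_graph :: "'v set \<Rightarrow> 'v set set \<Rightarrow> bool" where
  "complete_graph V E \<longleftrightarrow> finite V \<and> E = {e. e \<subseteq> V \<and> card e = 2}"

definition induced_edges :: "'v set set \<Rightarrow> 'v set \<Rightarrow> 'v set set" where
  "induced_edges E U = {e \<in> E. e \<subseteq> U}"

definition coord_space :: "'e::finite set \<Rightarrow> (real ^ 'e) set" where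
  "coord_space E = {x. \<forall>e. e \<notin> E \<longrightarrow> x $ e = 0}"

definition forest_polytope :: "'v::finite set \<Rightarrow> 'v set set \<Rightarrow> (real ^ 'v set) set" where
  "forest_polytope V E = {x \<in> coord_space E.
     (\<forall>U. U \<noteq> {} \<and> U \<subseteq> V \<longrightarrow> (\<Sum>e\<in>induced_edges E U. x $ e) \<le> real (card U) - 1) \<and>
     (\<forall>e\<in>E. 0 \<le> x $ e)}"

text \<open>
  A constraint matrix is a finite set \<open>I\<close> of row indices together with the row vectors
  \<open>B i\<close>, so that the \<open>i\<close>-th component of \<open>B x\<close> is \<open>B i \<bullet> x\<close>.
\<close>

definition row_support :: "'r set \<Rightarrow> ('r \<Rightarrow> real ^ 'e) \<Rightarrow> real ^ 'e \<Rightarrow> 'r set" where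
  "row_support I B x = {i \<in> I. B i \<bullet> x \<noteq> 0}"

definition coprime_integral :: "'e::finite set \<Rightarrow> real ^ 'e \<Rightarrow> bool" where
  "coprime_integral E g \<longleftrightarrow>
     (\<exists>c :: 'e \<Rightarrow> int. (\<forall>e\<in>E. g $ e = of_int (c e)) \<and> Gcd (c ` E) = 1)"

definition circuits :: "'e::finite set \<Rightarrow> 'r set \<Rightarrow> ('r \<Rightarrow> real ^ 'e) \<Rightarrow> (real ^ 'e) set" where
  "circuits E I B = {g \<in> coord_space E - {0}. coprime_integral E g \<and>
     \<not> (\<exists>x \<in> coord_space E - {0}. row_support I B x \<subset> row_support I B g)}"

text \<open>
  For the description of \<^const>\<open>forest_polytope\<close>, the row \<open>Inl U\<close> is the constraint of a
  nonempty \<open>U \<subseteq> V\<close> and the row \<open>Inr e\<close> is \<open>- x(e) \<le> 0\<close>.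
\<close>

definition forest_rows :: "'v set \<Rightarrow> 'v set set \<Rightarrow> ('v set + 'v set) set" where
  "forest_rows V E = {U. U \<noteq> {} \<and> U \<subseteq> V} <+> E"

definition forest_matrix :: "'v::finite set set \<Rightarrow> 'v set + 'v set \<Rightarrow> real ^ 'v set" where
  "forest_matrix E i = (case i of
     Inl U \<Rightarrow> (\<chi> e. if e \<in> induced_edges E U then 1 else 0)
   | Inr e \<Rightarrow> - axis e 1)"

definition forest_rhs :: "'v set + 'v set \<Rightarrow> real" where
  "forest_rhs i = (case i of Inl U \<Rightarrow> real (card U) - 1 | Inr e \<Rightarrow> 0)"

lemma forest_polytope_eq_description:
  "forest_polytope V E =
     {x \<in> coord_space E. \<forall>i \<in> forest_rows V E. forest_matrix E i \<bullet> x \<le> forest_rhs i}"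
proof -
  have "forest_matrix E (Inl U) \<bullet> x = (\<Sum>e\<in>induced_edges E U. x $ e)" for U and x :: "real ^ 'a set"
    by (simp add: forest_matrix_def inner_vec_def if_distrib[of "\<lambda>c. c * _"]
        sum.If_cases cong: if_cong)
  moreover have "forest_matrix E (Inr e) \<bullet> x = - (x $ e)" for e and x :: "real ^ 'a set"
    by (simp add: forest_matrix_def inner_axis')
  moreover have "(\<forall>i \<in> A <+> B. Q i) \<longleftrightarrow> (\<forall>a\<in>A. Q (Inl a)) \<and> (\<forall>b\<in>B. Q (Inr b))"
    for A B :: "'a set set" and Q
    by (auto simp: Plus_def)
  ultimately show ?thesis
    by (simp add: forest_polytope_def forest_rows_def forest_rhs_def)
qed

definition circuit_walk ::
    "'a::real_vector set \<Rightarrow> 'a set \<Rightarrow> nat \<Rightarrow> (nat \<Rightarrow> 'a) \<Rightarrow> bool" where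
  "circuit_walk P C k x \<longleftrightarrow>
     x 0 extreme_point_of P \<and> (\<forall>i\<le>k. x i \<in> P) \<and>
     (\<forall>i<k. \<exists>g\<in>C. \<exists>\<epsilon>>0. x (Suc i) = x i + \<epsilon> *\<^sub>R g \<and> (\<forall>\<delta>>\<epsilon>. x i + \<delta> *\<^sub>R g \<notin> P))"

text \<open>
  The minimum and the maximum are taken in the extended naturals, so a pair of extreme points
  not joined by any circuit walk has distance \<open>\<infinity>\<close>.
\<close>

definition circuit_dist :: "'a::real_vector set \<Rightarrow> 'a set \<Rightarrow> 'a \<Rightarrow> 'a \<Rightarrow> enat" where
  "circuit_dist P C u v = (INF k \<in> {k. \<exists>x. circuit_walk P C k x \<and> x 0 = u \<and> x k = v}. enat k)"

definition circuit_diameter :: "'a::real_vector set \<Rightarrow> 'a set \<Rightarrow> enat" where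
  "circuit_diameter P C =
     (SUP (u, v) \<in> {u. u extreme_point_of P} \<times> {v. v extreme_point_of P}. circuit_dist P C u v)"

end

theory Submission
  imports Defs
begin

text \<open>
  The extreme points are the characteristic vectors of forests (\<open>extreme_point_is_char_vec\<close>),
  and the walk only visits such vectors.  For the extreme points this is an uncrossing argument: a
  minimal tight vertex set around a fractional edge contains a second fractional edge, and shifting
  weight between the two keeps all tight constraints tight.

  A step along a circuit from one \<open>0/1\<close> point of the polytope to another is automatically of
  maximal length, because the polytope lies in the unit cube; moreover such a step can be reversed,
  because the negative of a circuit is a circuit.  So it suffices to connect any two forests by a
  chain of at most seven exchanges in which consecutive characteristic vectors differ by a circuit.

  The circuits that make a constant number of steps possible exchange a single edge \<open>h\<close> against
  a whole edge set \<open>F\<close> (\<open>exchange_circuit\<close>).  If \<open>h\<close> and any \<open>f \<in> F\<close> span no further edge of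
  \<open>F\<close>, then the constraint of the vertex set \<open>h \<union> f\<close> forces the coordinates of \<open>f\<close> and \<open>h\<close> to
  be opposite, so the vector is determined up to a scalar by the rows on which it vanishes.
  This holds for every \<open>F\<close> that has no edge at the two ends of \<open>h\<close>.

  A forest has a vertex \<open>a\<close> of degree at most one; deleting the edge there, and then the edge at
  a vertex \<open>b\<close> of degree at most one in the rest, takes at most two steps.  Now \<open>a\<close> and \<open>b\<close> are
  isolated, and a third step exchanges all that is left against the edge \<open>{a, b}\<close>.  Thus, if there
  are at least two vertices, every forest is within three steps of a single edge, any two single
  edges are within one step of each other, and the two forests are within \<open>3 + 1 + 3\<close> steps.
\<close>

section \<open>Rows of the constraint matrix\<close>

lemma forest_matrix_vertex_row:
  "forest_matrix E (Inl U) \<bullet> x = (\<Sum>e\<in>induced_edges E U. x $ e)"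
  by (simp add: forest_matrix_def inner_vec_def if_distrib[of "\<lambda>c. c * _"]
      sum.If_cases cong: if_cong)

lemma forest_matrix_edge_row: "forest_matrix E (Inr e) \<bullet> x = - (x $ e)"
  by (simp add: forest_matrix_def inner_axis')

lemma forest_rows_iff:
  "Inl U \<in> forest_rows V E \<longleftrightarrow> U \<noteq> {} \<and> U \<subseteq> V"
  "Inr e \<in> forest_rows V E \<longleftrightarrow> e \<in> E"
  by (auto simp: forest_rows_def)

lemma forest_polytope_sum_le:
  assumes "x \<in> forest_polytope V E" "U \<noteq> {}" "U \<subseteq> V"
  shows "(\<Sum>e\<in>induced_edges E U. x $ e) \<le> real (card U) - 1"
  using assms by (auto simp: forest_polytope_def)

lemma forest_polytope_nonneg: "x \<in> forest_polytope V E \<Longrightarrow> 0 \<le> x $ e"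
  by (cases "e \<in> E") (auto simp: forest_polytope_def coord_space_def)

lemma complete_graph_edge:
  assumes "complete_graph V E" "e \<in> E"
  shows "e \<subseteq> V" "card e = 2" "e \<noteq> {}"
  using assms by (auto simp: complete_graph_def)

lemma forest_polytope_le_1:
  assumes G: "complete_graph V E" and x: "x \<in> forest_polytope V E" and e: "e \<in> E"
  shows "x $ e \<le> 1"
proof -
  have "f = e" if "f \<in> E" "f \<subseteq> e" for f
    using complete_graph_edge(2)[OF G] that e by (intro card_subset_eq) auto
  then have "induced_edges E e = {e}" using e by (auto simp: induced_edges_def)
  then show ?thesis
    using forest_polytope_sum_le[OF x, of e] complete_graph_edge[OF G e] by simp
qed

section \<open>Extreme points are characteristic vectors\<close>

definition char_vec :: "'e::finite set \<Rightarrow> real ^ 'e" where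
  "char_vec F = (\<chi> e. if e \<in> F then 1 else 0)"

lemma char_vec_nth [simp]: "char_vec F $ e = (if e \<in> F then 1 else 0)"
  by (simp add: char_vec_def)

lemma sum_char_vec: "(\<Sum>e\<in>A. char_vec F $ e) = real (card (A \<inter> F))"
  by (simp add: sum.If_cases)

lemma not_extreme_point_perturb:
  fixes x d :: "real ^ 'e::finite"
  assumes P: "P = {x \<in> coord_space E. \<forall>i\<in>I. B i \<bullet> x \<le> b i}" and "finite I"
    and x: "x \<in> P" and d: "d \<in> coord_space E" "d \<noteq> 0"
    and tight: "\<And>i. i \<in> I \<Longrightarrow> B i \<bullet> x = b i \<Longrightarrow> B i \<bullet> d = 0"
  shows "\<not> x extreme_point_of P"
proof -
  have "\<forall>\<^sub>F t in at_right 0. t * \<bar>B i \<bullet> d\<bar> \<le> b i - B i \<bullet> x" if i: "i \<in> I" for i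
  proof (cases "B i \<bullet> x = b i")
    case True
    then show ?thesis using tight[OF i] by simp
  next
    case False
    with x i P have pos: "0 < b i - B i \<bullet> x" by force
    have "((\<lambda>t. t * \<bar>B i \<bullet> d\<bar>) \<longlongrightarrow> 0 * \<bar>B i \<bullet> d\<bar>) (at_right 0)"
      by (intro tendsto_intros)
    then have "\<forall>\<^sub>F t in at_right 0. t * \<bar>B i \<bullet> d\<bar> < b i - B i \<bullet> x"
      using pos by (intro order_tendstoD) auto
    then show ?thesis by (rule eventually_mono) simp
  qed
  then have "\<forall>\<^sub>F t in at_right 0. \<forall>i\<in>I. t * \<bar>B i \<bullet> d\<bar> \<le> b i - B i \<bullet> x"
    using \<open>finite I\<close> by (simp add: eventually_ball_finite)
  moreover have "\<forall>\<^sub>F t::real in at_right 0. 0 < t"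
    by (simp add: eventually_at_right_less)
  ultimately have "\<forall>\<^sub>F t in at_right 0. 0 < t \<and> (\<forall>i\<in>I. t * \<bar>B i \<bullet> d\<bar> \<le> b i - B i \<bullet> x)"
    by (simp add: eventually_conj)
  then have "\<exists>t>0. \<forall>i\<in>I. t * \<bar>B i \<bullet> d\<bar> \<le> b i - B i \<bullet> x"
    using eventually_happens[of _ "at_right (0::real)"] by simp
  then obtain t where t: "0 < t" "\<And>i. i \<in> I \<Longrightarrow> t * \<bar>B i \<bullet> d\<bar> \<le> b i - B i \<bullet> x"
    by blast
  have t': "t * (B i \<bullet> d) \<le> b i - B i \<bullet> x" "- (t * (B i \<bullet> d)) \<le> b i - B i \<bullet> x"
    if "i \<in> I" for i
    using t(2)[OF that] t(1) abs_le_iff[of "t * (B i \<bullet> d)"] by (auto simp: abs_mult)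
  have "x + t *\<^sub>R d \<in> P" "x - t *\<^sub>R d \<in> P"
    using x d(1) t' by (force simp: P coord_space_def inner_add_right inner_diff_right)+
  moreover have "x \<in> open_segment (x + t *\<^sub>R d) (x - t *\<^sub>R d)"
  proof -
    have "x + t *\<^sub>R d \<noteq> x - t *\<^sub>R d" using t(1) d(2) by (auto simp: vec_eq_iff)
    moreover have "midpoint (x + t *\<^sub>R d) (x - t *\<^sub>R d) = x"
      by (simp add: midpoint_def vec_eq_iff)
    ultimately show ?thesis by (metis midpoint_in_open_segment)
  qed
  ultimately show ?thesis by (auto simp: extreme_point_of_def)
qed

text \<open>
  Since \<open>x \<ge> 0\<close>, the function \<open>U \<mapsto> x(E[U])\<close> is supermodular, while \<open>U \<mapsto> |U| - 1\<close> is modular on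
  intersecting sets.  So for tight \<open>U\<close> and \<open>W\<close> the constraints of \<open>U \<union> W\<close> and \<open>U \<inter> W\<close> can only
  hold with equality.
\<close>
lemma tight_sets_inter:
  fixes x :: "real ^ 'v::finite set"
  assumes x: "x \<in> forest_polytope V E"
    and U: "U \<subseteq> V" "(\<Sum>e\<in>induced_edges E U. x $ e) = real (card U) - 1"
    and W: "W \<subseteq> V" "(\<Sum>e\<in>induced_edges E W. x $ e) = real (card W) - 1"
    and ne: "U \<inter> W \<noteq> {}"
  shows "(\<Sum>e\<in>induced_edges E (U \<inter> W). x $ e) = real (card (U \<inter> W)) - 1"
proof -
  let ?s = "\<lambda>U. \<Sum>e\<in>induced_edges E U. x $ e"
  have "?s U + ?s W = (\<Sum>e\<in>induced_edges E U \<union> induced_edges E W. x $ e)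
      + (\<Sum>e\<in>induced_edges E U \<inter> induced_edges E W. x $ e)"
    by (simp add: sum.union_inter)
  also have "induced_edges E U \<inter> induced_edges E W = induced_edges E (U \<inter> W)"
    by (auto simp: induced_edges_def)
  also have "(\<Sum>e\<in>induced_edges E U \<union> induced_edges E W. x $ e) \<le> ?s (U \<union> W)"
    by (rule sum_mono2) (auto simp: induced_edges_def forest_polytope_nonneg[OF x])
  finally have "?s U + ?s W \<le> ?s (U \<union> W) + ?s (U \<inter> W)" by simp
  moreover have "?s (U \<union> W) \<le> real (card (U \<union> W)) - 1"
    using U(1) W(1) ne by (intro forest_polytope_sum_le[OF x]) auto
  moreover have "?s (U \<inter> W) \<le> real (card (U \<inter> W)) - 1"
    using U(1) ne by (intro forest_polytope_sum_le[OF x]) auto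
  moreover have "real (card U) + real (card W) = real (card (U \<union> W)) + real (card (U \<inter> W))"
    using card_Un_Int[of U W] by simp
  ultimately show ?thesis using U(2) W(2) by linarith
qed

text \<open>
  A fractional edge allows a perturbation in both directions: on its own if it lies in no tight
  set, and otherwise against another fractional edge of a minimal tight set.
\<close>
lemma extreme_point_is_char_vec:
  fixes V :: "'v::finite set"
  assumes G: "complete_graph V E" and ext: "x extreme_point_of forest_polytope V E"
  shows "\<exists>F\<subseteq>E. x = char_vec F"
proof -
  let ?s = "\<lambda>U. \<Sum>e\<in>induced_edges E U. x $ e"
  define frac where "frac = {e \<in> E. 0 < x $ e \<and> x $ e < 1}"
  define tight where "tight U \<longleftrightarrow> U \<noteq> {} \<and> U \<subseteq> V \<and> ?s U = real (card U) - 1" for U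
  have x: "x \<in> forest_polytope V E" using ext by (simp add: extreme_point_of_def)
  have no_perturb: False
    if d: "d \<in> coord_space E" "d \<noteq> 0" and "\<And>e. x $ e = 0 \<Longrightarrow> d $ e = 0"
      and "\<And>U. tight U \<Longrightarrow> (\<Sum>e\<in>induced_edges E U. d $ e) = 0" for d
  proof -
    have "\<not> x extreme_point_of forest_polytope V E"
    proof (rule not_extreme_point_perturb[OF forest_polytope_eq_description _ x d])
      fix i assume "i \<in> forest_rows V E" "forest_matrix E i \<bullet> x = forest_rhs i"
      then show "forest_matrix E i \<bullet> d = 0"
        using that by (cases i)
          (auto simp: forest_matrix_vertex_row forest_matrix_edge_row forest_rows_iff
            forest_rhs_def tight_def)
    qed simp
    with ext show False by simp
  qed
  have "frac = {}"
  proof (rule ccontr)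
    assume "frac \<noteq> {}"
    show False
    proof (cases "\<exists>U. tight U \<and> induced_edges frac U \<noteq> {}")
      case False
      from \<open>frac \<noteq> {}\<close> obtain f where f: "f \<in> frac" by blast
      show False
      proof (rule no_perturb[of "axis f 1"])
        fix U assume "tight U"
        with False f have "f \<notin> induced_edges E U" by (auto simp: induced_edges_def)
        then show "(\<Sum>e\<in>induced_edges E U. axis f 1 $ e) = (0::real)"
          by (auto simp: axis_def intro!: sum.neutral)
      qed (use f in \<open>auto simp: frac_def coord_space_def axis_def vec_eq_iff\<close>)
    next
      case True
      then obtain U where U: "tight U" "induced_edges frac U \<noteq> {}"
        and min: "\<And>W. tight W \<Longrightarrow> induced_edges frac W \<noteq> {} \<Longrightarrow> card U \<le> card W"
        using ex_has_least_nat[of "\<lambda>U. tight U \<and> induced_edges frac U \<noteq> {}" _ card] by blast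
      from U(2) obtain f where f: "f \<in> frac" "f \<subseteq> U" by (auto simp: induced_edges_def)
      \<comment> \<open>The sum over \<open>E[U]\<close> is the integer \<open>|U| - 1\<close>, so \<open>f\<close> is not its only fractional term.\<close>
      have "\<exists>h \<in> frac. h \<subseteq> U \<and> h \<noteq> f"
      proof (rule ccontr)
        assume none: "\<not> ?thesis"
        have "x $ e \<in> \<int>" if "e \<in> induced_edges E U - {f}" for e
        proof -
          have "e \<in> E" "e \<notin> frac" using that none by (auto simp: induced_edges_def)
          then have "x $ e = 0 \<or> x $ e = 1"
            using forest_polytope_nonneg[OF x, of e] forest_polytope_le_1[OF G x, of e]
            by (auto simp: frac_def)
          then show ?thesis by auto
        qed
        then have "(\<Sum>e\<in>induced_edges E U - {f}. x $ e) \<in> \<int>" by (rule Ints_sum)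
        moreover have "?s U = x $ f + (\<Sum>e\<in>induced_edges E U - {f}. x $ e)"
          using f by (intro sum.remove) (auto simp: induced_edges_def frac_def)
        moreover have "?s U \<in> \<int>" using U(1) by (simp add: tight_def)
        ultimately have "x $ f \<in> \<int>" by (metis Ints_diff add_diff_cancel_right')
        then show False using f(1) by (auto simp: frac_def elim!: Ints_cases)
      qed
      then obtain h where h: "h \<in> frac" "h \<subseteq> U" "h \<noteq> f" by blast
      have whole: "U \<subseteq> W" if W: "tight W" and e: "e \<in> frac" "e \<subseteq> U" "e \<subseteq> W" for W e
      proof -
        have "e \<noteq> {}" using e(1) complete_graph_edge[OF G] by (auto simp: frac_def)
        with e have ne: "U \<inter> W \<noteq> {}" by blast
        then have "tight (U \<inter> W)"
          using tight_sets_inter[OF x _ _ _ _ ne] U(1) W by (auto simp: tight_def)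
        then have "card U \<le> card (U \<inter> W)" using e by (intro min) (auto simp: induced_edges_def)
        then have "U \<inter> W = U" by (intro card_seteq) auto
        then show ?thesis by blast
      qed
      show False
      proof (rule no_perturb[of "axis f 1 - axis h 1"])
        fix W assume W: "tight W"
        have "f \<subseteq> W \<longleftrightarrow> h \<subseteq> W" using whole[OF W] f h by blast
        then have "f \<in> induced_edges E W \<longleftrightarrow> h \<in> induced_edges E W"
          using f h by (auto simp: induced_edges_def frac_def)
        then show "(\<Sum>e\<in>induced_edges E W. (axis f 1 - axis h 1) $ e) = (0::real)"
          by (simp add: axis_def sum_subtractf)
      qed (use f h in \<open>auto simp: frac_def coord_space_def axis_def vec_eq_iff\<close>)
    qed
  qed
  have "x $ e = 1" if "x $ e \<noteq> 0" for e
  proof -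
    have "e \<in> E" using x that by (auto simp: forest_polytope_def coord_space_def)
    moreover from this have "\<not> (0 < x $ e \<and> x $ e < 1)" using \<open>frac = {}\<close> by (auto simp: frac_def)
    ultimately show ?thesis
      using that forest_polytope_nonneg[OF x, of e] forest_polytope_le_1[OF G x, of e] by simp
  qed
  then have "x = char_vec {e. x $ e \<noteq> 0}" by (simp add: vec_eq_iff)
  moreover have "{e. x $ e \<noteq> 0} \<subseteq> E"
    using x by (auto simp: forest_polytope_def coord_space_def)
  ultimately show ?thesis by blast
qed

section \<open>Forests\<close>

definition forest :: "'v::finite set \<Rightarrow> 'v set set \<Rightarrow> 'v set set \<Rightarrow> bool" where
  "forest V E F \<longleftrightarrow> F \<subseteq> E \<and> char_vec F \<in> forest_polytope V E"

lemma forest_iff: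
  "forest V E F \<longleftrightarrow> F \<subseteq> E \<and> (\<forall>U. U \<noteq> {} \<and> U \<subseteq> V \<longrightarrow> card (induced_edges F U) < card U)"
proof -
  have "induced_edges E U \<inter> F = induced_edges F U" if "F \<subseteq> E" for U
    using that by (auto simp: induced_edges_def)
  then have "real (card (induced_edges E U \<inter> F)) \<le> real (card U) - 1
      \<longleftrightarrow> card (induced_edges F U) < card U" if "F \<subseteq> E" for U
    using that by (simp add: le_diff_eq) linarith
  then show ?thesis
    unfolding forest_def forest_polytope_def mem_Collect_eq sum_char_vec
    by (auto simp: coord_space_def)
qed

lemma forest_subset:
  assumes "forest V E F" "F' \<subseteq> F"
  shows "forest V E F'"
proof -
  have "card (induced_edges F' U) \<le> card (induced_edges F U)" for U
    using assms(2) by (intro card_mono) (auto simp: induced_edges_def)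
  then show ?thesis using assms unfolding forest_iff by (meson le_less_trans subset_trans)
qed

lemma forest_single:
  assumes G: "complete_graph V E" and e: "e \<in> E"
  shows "forest V E {e}"
  unfolding forest_iff
proof (intro conjI allI impI)
  fix U assume U: "U \<noteq> {} \<and> U \<subseteq> V"
  show "card (induced_edges {e} U) < card U"
  proof (cases "e \<subseteq> U")
    case True
    then have "induced_edges {e} U = {e}" by (auto simp: induced_edges_def)
    then show ?thesis using card_mono[OF _ True] complete_graph_edge[OF G e] by simp
  next
    case False
    then have "induced_edges {e} U = {}" by (auto simp: induced_edges_def)
    then show ?thesis using U by (simp add: card_gt_0_iff)
  qed
qed (use e in simp)

text \<open>
  The degrees in \<open>F[U]\<close> add up to twice the number of its edges, which is less than \<open>2|U|\<close>.
\<close>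
lemma forest_low_degree_vertex:
  assumes G: "complete_graph V E" and F: "forest V E F" and U: "U \<noteq> {}" "U \<subseteq> V"
  shows "\<exists>v\<in>U. card {e \<in> induced_edges F U. v \<in> e} \<le> 1"
proof (rule ccontr)
  assume "\<not> ?thesis"
  then have "(\<Sum>v\<in>U. 2) \<le> (\<Sum>v\<in>U. card {e \<in> induced_edges F U. v \<in> e})"
    by (intro sum_mono) (auto simp: not_le)
  also have "\<dots> = 2 * card (induced_edges F U)"
  proof (rule sum_multicount, simp_all, intro ballI)
    fix e assume e: "e \<in> induced_edges F U"
    then have "{v \<in> U. v \<in> e} = e" "e \<in> E" using F by (auto simp: induced_edges_def forest_iff)
    then show "card {v \<in> U. v \<in> e} = 2" using complete_graph_edge(2)[OF G] by simp
  qed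
  finally have "card U \<le> card (induced_edges F U)" by simp
  then show False using F U by (auto simp: forest_iff not_less)
qed

section \<open>Exchange circuits\<close>

lemma row_support_scaleR:
  assumes "c \<noteq> 0"
  shows "row_support I B (c *\<^sub>R x) = row_support I B x"
  using assms by (simp add: row_support_def)

lemma uminus_circuit:
  assumes "g \<in> circuits E I B"
  shows "- g \<in> circuits E I B"
proof -
  have "row_support I B (- g) = row_support I B g"
    using row_support_scaleR[of "-1" I B g] by simp
  moreover have "coprime_integral E (- g)"
  proof -
    from assms obtain c :: "_ \<Rightarrow> int"
      where c: "\<forall>e\<in>E. g $ e = of_int (c e)" "Gcd (c ` E) = 1"
      by (auto simp: circuits_def coprime_integral_def)
    have dvd: "z dvd Gcd ((\<lambda>e. - c e) ` E) \<longleftrightarrow> z dvd Gcd (c ` E)" for z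
      by (simp add: dvd_Gcd_iff)
    have "Gcd ((\<lambda>e. - c e) ` E) = Gcd (c ` E)"
      by (rule associated_eqI[OF iffD1[OF dvd dvd_refl] iffD2[OF dvd dvd_refl] normalize_Gcd normalize_Gcd])
    with c(2) have "Gcd ((\<lambda>e. - c e) ` E) = 1" by (rule trans[rotated])
    moreover have "\<forall>e\<in>E. (- g) $ e = of_int (- c e)" using c(1) by simp
    ultimately show ?thesis
      unfolding coprime_integral_def by (intro exI[of _ "\<lambda>e. - c e"] conjI)
  qed
  ultimately show ?thesis using assms by (auto simp: circuits_def coord_space_def)
qed

text \<open>
  A vector whose row support is contained in that of \<open>char_vec {h} - char_vec F\<close> vanishes off
  \<open>F \<union> {h}\<close>, and the row of the vertex set \<open>f \<union> h\<close> shows that its coordinate at \<open>f\<close> is the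
  negative of that at \<open>h\<close>.
\<close>
lemma exchange_circuit:
  fixes V :: "'v::finite set"
  assumes G: "complete_graph V E" and h: "h \<in> E" "h \<notin> F" and F: "F \<subseteq> E"
    and spanned: "\<And>f f'. f \<in> F \<Longrightarrow> f' \<in> F \<Longrightarrow> f' \<subseteq> f \<union> h \<Longrightarrow> f' = f"
  shows "char_vec {h} - char_vec F \<in> circuits E (forest_rows V E) (forest_matrix E)"
proof -
  let ?g = "char_vec {h} - char_vec F"
  let ?supp = "row_support (forest_rows V E) (forest_matrix E)"
  have multiple: "x = (x $ h) *\<^sub>R ?g" if x: "x \<in> coord_space E" and sub: "?supp x \<subseteq> ?supp ?g" for x
  proof -
    have row: "forest_matrix E i \<bullet> x = 0" if "i \<in> forest_rows V E" "forest_matrix E i \<bullet> ?g = 0" for i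
      using sub that by (auto simp: row_support_def)
    have off: "x $ e = 0" if "e \<notin> F" "e \<noteq> h" for e
      using x row[of "Inr e"] that
      by (cases "e \<in> E") (auto simp: coord_space_def forest_rows_iff forest_matrix_edge_row)
    have "x $ f = - x $ h" if f: "f \<in> F" for f
    proof -
      let ?S = "induced_edges E (f \<union> h)"
      have sum: "(\<Sum>e\<in>?S. y $ e) = y $ f + y $ h"
        if "\<And>e. e \<notin> F \<Longrightarrow> e \<noteq> h \<Longrightarrow> y $ e = 0" for y :: "real ^ 'v set"
      proof -
        have "(\<Sum>e\<in>?S. y $ e) = (\<Sum>e\<in>{f, h}. y $ e)"
          by (rule sum.mono_neutral_right)
            (use f F h spanned[OF f] that in \<open>auto simp: induced_edges_def\<close>)
        also have "\<dots> = y $ f + y $ h" using f h by (subst sum.insert) auto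
        finally show ?thesis .
      qed
      have "Inl (f \<union> h) \<in> forest_rows V E"
        using f F h complete_graph_edge[OF G] by (auto simp: forest_rows_iff)
      moreover have "forest_matrix E (Inl (f \<union> h)) \<bullet> ?g = 0"
        unfolding forest_matrix_vertex_row using f h by (subst sum) auto
      ultimately have "forest_matrix E (Inl (f \<union> h)) \<bullet> x = 0" by (rule row)
      then show ?thesis unfolding forest_matrix_vertex_row using sum[of x] off by simp
    qed
    with off h show ?thesis by (auto simp: vec_eq_iff)
  qed
  have "?g \<in> coord_space E" using h F by (auto simp: coord_space_def)
  moreover have "?g \<noteq> 0" using h by (auto simp: vec_eq_iff intro!: exI[of _ h])
  moreover have "coprime_integral E ?g"
  proof -
    let ?c = "\<lambda>e. (if e = h then 1 else 0) - (if e \<in> F then 1 else 0) :: int"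
    have "?c h = 1" using h by simp
    then have "1 \<in> ?c ` E" using h(1) by (intro rev_image_eqI[of h]) auto
    then have "Gcd (?c ` E) = 1" by (rule Gcd_eq_1_I[rotated]) simp
    then show ?thesis
      unfolding coprime_integral_def by (intro exI[of _ ?c]) auto
  qed
  moreover have "\<not> ?supp x \<subset> ?supp ?g" if x: "x \<in> coord_space E - {0}" for x
  proof
    assume sub: "?supp x \<subset> ?supp ?g"
    then have eq: "x = (x $ h) *\<^sub>R ?g" using x by (intro multiple) auto
    have "x $ h \<noteq> 0"
    proof
      assume "x $ h = 0"
      then have "(x $ h) *\<^sub>R ?g = 0" by simp
      with eq have "x = 0" by (rule trans)
      with x show False by simp
    qed
    then have "?supp ((x $ h) *\<^sub>R ?g) = ?supp ?g" by (rule row_support_scaleR)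
    with arg_cong[OF eq, of ?supp] have "?supp x = ?supp ?g" by (rule trans)
    with sub show False by simp
  qed
  ultimately show ?thesis by (auto simp: circuits_def)
qed

section \<open>Walks along forests\<close>

definition exchange :: "'v::finite set \<Rightarrow> 'v set set \<Rightarrow> ('v set set \<times> 'v set set) set" where
  "exchange V E = {(F, F'). forest V E F \<and> forest V E F' \<and>
     char_vec F' - char_vec F \<in> circuits E (forest_rows V E) (forest_matrix E)}"

lemma sym_exchange: "sym (exchange V E)"
proof (rule symI)
  fix F F' assume "(F, F') \<in> exchange V E"
  then have ex: "forest V E F" "forest V E F'"
    "char_vec F' - char_vec F \<in> circuits E (forest_rows V E) (forest_matrix E)"
    by (auto simp: exchange_def)
  have "char_vec F - char_vec F' \<in> circuits E (forest_rows V E) (forest_matrix E)"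
    using uminus_circuit[OF ex(3)] by simp
  with ex show "(F', F) \<in> exchange V E" by (simp add: exchange_def)
qed

text \<open>
  Moving from one \<open>0/1\<close> point to a different one, some coordinate goes from \<open>0\<close> to \<open>1\<close> or from
  \<open>1\<close> to \<open>0\<close>, and any further step would leave the unit interval in this coordinate.
\<close>
lemma exchange_step_maximal:
  assumes G: "complete_graph V E" and ex: "(F, F') \<in> exchange V E" and \<delta>: "1 < \<delta>"
  shows "char_vec F + \<delta> *\<^sub>R (char_vec F' - char_vec F) \<notin> forest_polytope V E"
    (is "?y \<notin> _")
proof
  assume y: "?y \<in> forest_polytope V E"
  have "F \<noteq> F'" using ex by (auto simp: exchange_def circuits_def)
  then obtain e where e: "e \<in> F \<longleftrightarrow> e \<notin> F'" by blast
  have "F \<union> F' \<subseteq> E" using ex by (auto simp: exchange_def forest_def)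
  with e have "e \<in> E" by blast
  then have "0 \<le> ?y $ e" "?y $ e \<le> 1"
    using forest_polytope_nonneg[OF y] forest_polytope_le_1[OF G y] by blast+
  then show False using e \<delta> by (auto split: if_splits)
qed

lemma circuit_dist_le:
  assumes G: "complete_graph V E" and ext: "char_vec F extreme_point_of forest_polytope V E"
    and F: "(F, F') \<in> exchange V E ^^ k"
  shows "circuit_dist (forest_polytope V E) (circuits E (forest_rows V E) (forest_matrix E))
    (char_vec F) (char_vec F') \<le> enat k"
proof -
  from F obtain H where H: "H 0 = F" "H k = F'" "\<And>i. i < k \<Longrightarrow> (H i, H (Suc i)) \<in> exchange V E"
    unfolding relpow_fun_conv by blast
  let ?x = "\<lambda>i. char_vec (H i)"
  have "circuit_walk (forest_polytope V E) (circuits E (forest_rows V E) (forest_matrix E)) k ?x"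
    unfolding circuit_walk_def
  proof (intro conjI allI impI)
    show "?x 0 extreme_point_of forest_polytope V E" using ext H by simp
  next
    fix i assume "i \<le> k"
    show "?x i \<in> forest_polytope V E"
    proof (cases i)
      case 0
      then show ?thesis using ext H by (simp add: extreme_point_of_def)
    next
      case (Suc j)
      then show ?thesis using H(3)[of j] \<open>i \<le> k\<close> by (simp add: exchange_def forest_def)
    qed
  next
    fix i assume "i < k"
    then have step: "(H i, H (Suc i)) \<in> exchange V E" by (rule H(3))
    show "\<exists>g\<in>circuits E (forest_rows V E) (forest_matrix E). \<exists>\<epsilon>>0.
        ?x (Suc i) = ?x i + \<epsilon> *\<^sub>R g \<and> (\<forall>\<delta>>\<epsilon>. ?x i + \<delta> *\<^sub>R g \<notin> forest_polytope V E)"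
      using step exchange_step_maximal[OF G step]
      by (intro bexI[of _ "?x (Suc i) - ?x i"] exI[of _ 1]) (auto simp: exchange_def)
  qed
  then show ?thesis
    unfolding circuit_dist_def using H(1,2) by (intro INF_lower) auto
qed

section \<open>Chains of exchanges\<close>

lemma relpow_reflcl_le:
  assumes "(x, y) \<in> (R\<^sup>=) ^^ n"
  shows "\<exists>k\<le>n. (x, y) \<in> R ^^ k"
  using assms
proof (induction n arbitrary: y)
  case (Suc n)
  from Suc.prems obtain z where z: "(x, z) \<in> (R\<^sup>=) ^^ n" "(z, y) \<in> R\<^sup>="
    by (rule relpow_Suc_E)
  from Suc.IH[OF z(1)] obtain k where k: "k \<le> n" "(x, z) \<in> R ^^ k" by blast
  show ?case
  proof (cases "z = y")
    case True
    with k(2) have "(x, y) \<in> R ^^ k" by simp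
    moreover have "k \<le> Suc n" using k(1) by simp
    ultimately show ?thesis by blast
  next
    case False
    with z(2) have "(z, y) \<in> R" by simp
    with k(2) have "(x, y) \<in> R ^^ Suc k" by (rule relpow_Suc_I)
    moreover have "Suc k \<le> Suc n" using k(1) by simp
    ultimately show ?thesis by blast
  qed
qed simp

lemma sym_relpow:
  assumes "sym R"
  shows "sym (R ^^ n)"
proof (induction n)
  case (Suc n)
  have "(R O R ^^ n)\<inverse> = R O R ^^ n"
    using assms Suc by (simp add: converse_relcomp sym_conv_converse_eq flip: relpow_commute)
  then show ?case by (simp add: sym_conv_converse_eq relpow_commute)
qed (simp add: sym_Id)

lemma exchange_single_edges:
  assumes G: "complete_graph V E" and "e \<in> E" "h \<in> E"
  shows "({e}, {h}) \<in> (exchange V E)\<^sup>="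
proof (cases "e = h")
  case False
  then have "char_vec {h} - char_vec {e} \<in> circuits E (forest_rows V E) (forest_matrix E)"
    using assms by (intro exchange_circuit[OF G]) auto
  then show ?thesis using assms by (simp add: exchange_def forest_single)
qed simp

text \<open>
  At a vertex of degree at most one there is at most one edge to delete, and deleting a single edge
  \<open>h\<close> is the negative of the exchange circuit of \<open>h\<close> against the empty set.
\<close>
lemma exchange_isolate_vertex:
  assumes G: "complete_graph V E" and F: "forest V E F" and U: "U \<noteq> {}" "U \<subseteq> V"
    and inside: "\<forall>e\<in>F. e \<subseteq> U"
  obtains v F' where "v \<in> U" "F' \<subseteq> F" "\<forall>e\<in>F'. e \<subseteq> U - {v}" "(F, F') \<in> (exchange V E)\<^sup>="
proof -
  from forest_low_degree_vertex[OF G F U] obtain v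
    where v: "v \<in> U" "card {e \<in> induced_edges F U. v \<in> e} \<le> 1" by blast
  have "induced_edges F U = F" using inside by (auto simp: induced_edges_def)
  with v have deg: "card {e \<in> F. v \<in> e} \<le> 1" by simp
  let ?F' = "{e \<in> F. v \<notin> e}"
  have "(F, ?F') \<in> (exchange V E)\<^sup>="
  proof (cases "{e \<in> F. v \<in> e} = {}")
    case True
    then have "?F' = F" by auto
    then show ?thesis by simp
  next
    case False
    with deg have "card {e \<in> F. v \<in> e} = 1"
      by (metis One_nat_def card_gt_0_iff finite le_antisym Suc_leI)
    then obtain h where h: "{e \<in> F. v \<in> e} = {h}" by (rule card_1_singletonE)
    then have "h \<in> E" using F by (auto simp: forest_def)
    then have "char_vec {h} - char_vec {} \<in> circuits E (forest_rows V E) (forest_matrix E)"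
      by (intro exchange_circuit[OF G]) auto
    moreover have "char_vec ?F' - char_vec F = - (char_vec {h} - char_vec {})"
      using h by (auto simp: vec_eq_iff)
    ultimately have "char_vec ?F' - char_vec F \<in> circuits E (forest_rows V E) (forest_matrix E)"
      by (simp only: uminus_circuit)
    then show ?thesis using F forest_subset[OF F, of ?F'] by (auto simp: exchange_def)
  qed
  then show ?thesis using inside v(1) by (intro that[of v ?F']) auto
qed

lemma exchange_to_single_edge:
  assumes G: "complete_graph V E" and F: "forest V E F" and V: "2 \<le> card V"
  shows "\<exists>h\<in>E. (F, {h}) \<in> ((exchange V E)\<^sup>=) ^^ 3"
proof -
  have ne: "V \<noteq> {}" using V by auto
  have inside: "\<forall>e\<in>F. e \<subseteq> V"
    using F complete_graph_edge(1)[OF G] by (auto simp only: forest_def dest: subsetD)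
  obtain a F1 where a: "a \<in> V" and F1: "F1 \<subseteq> F" "\<forall>e\<in>F1. e \<subseteq> V - {a}"
      "(F, F1) \<in> (exchange V E)\<^sup>="
    by (rule exchange_isolate_vertex[OF G F ne subset_refl inside])
  have forest1: "forest V E F1" by (rule forest_subset[OF F F1(1)])
  have "card (V - {a}) \<noteq> 0" using V a by simp
  then have ne1: "V - {a} \<noteq> {}" by force
  obtain b F2 where b: "b \<in> V - {a}" and F2: "F2 \<subseteq> F1"
      "\<forall>e\<in>F2. e \<subseteq> V - {a} - {b}" "(F1, F2) \<in> (exchange V E)\<^sup>="
    by (rule exchange_isolate_vertex[OF G forest1 ne1 Diff_subset F1(2)])
  \<comment> \<open>No edge of \<open>F2\<close> meets \<open>{a, b}\<close>, so an edge of \<open>F2\<close> inside \<open>f \<union> {a, b}\<close> lies inside \<open>f\<close>.\<close>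
  let ?h = "{a, b}"
  have h: "?h \<in> E" using G a b by (auto simp: complete_graph_def)
  have forest2: "forest V E F2" by (rule forest_subset[OF forest1 F2(1)])
  have "char_vec {?h} - char_vec F2 \<in> circuits E (forest_rows V E) (forest_matrix E)"
  proof (rule exchange_circuit[OF G h])
    show "?h \<notin> F2" using F2(2) by auto
    show F2E: "F2 \<subseteq> E" using forest2 by (simp add: forest_def)
    fix f f' assume f: "f \<in> F2" "f' \<in> F2" "f' \<subseteq> f \<union> ?h"
    have "f' \<subseteq> V - {a} - {b}" using F2(2) f(2) by (rule bspec)
    with f(3) have "f' \<subseteq> f" by auto
    moreover have "card f' = 2" "card f = 2"
      using f F2E by (auto intro!: complete_graph_edge(2)[OF G])
    ultimately show "f' = f" by (intro card_subset_eq) auto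
  qed
  then have "(F2, {?h}) \<in> (exchange V E)\<^sup>="
    using forest2 forest_single[OF G h] by (simp add: exchange_def)
  with F1(3) F2(3) have "(F, {?h}) \<in> ((exchange V E)\<^sup>=) ^^ Suc (Suc (Suc 0))"
    by (intro relpow_Suc_I[OF relpow_Suc_I[OF relpow_Suc_I[OF relpow_0_I]]])
  then have "(F, {?h}) \<in> ((exchange V E)\<^sup>=) ^^ 3" by (simp only: numeral_3_eq_3)
  with h show ?thesis by blast
qed

lemma exchange_diameter:
  assumes G: "complete_graph V E" and F: "forest V E F" and F': "forest V E F'"
    and V: "2 \<le> card V"
  shows "(F, F') \<in> ((exchange V E)\<^sup>=) ^^ 7"
proof -
  let ?R = "(exchange V E)\<^sup>="
  obtain h where h: "h \<in> E" "(F, {h}) \<in> ?R ^^ 3"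
    using exchange_to_single_edge[OF G F V] by blast
  obtain h' where h': "h' \<in> E" "(F', {h'}) \<in> ?R ^^ 3"
    using exchange_to_single_edge[OF G F' V] by blast
  have "sym ?R" using sym_exchange[of V E] by (simp add: sym_Un sym_Id)
  then have "sym (?R ^^ 3)" by (rule sym_relpow)
  then have "({h'}, F') \<in> ?R ^^ 3" using h'(2) by (rule symD)
  moreover have "({h}, {h'}) \<in> ?R ^^ 1"
    using exchange_single_edges[OF G h(1) h'(1)] by (simp only: relpow_1)
  ultimately have "(F, F') \<in> ?R ^^ 3 O (?R ^^ 1 O ?R ^^ 3)"
    using h(2) by (intro relcompI)
  then have "(F, F') \<in> ?R ^^ (3 + (1 + 3))" by (simp only: relpow_add)
  moreover have "3 + (1 + 3) = (7::nat)" by simp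
  ultimately show ?thesis by (simp only:)
qed

theorem theorem4p14:
  fixes V :: "'v::finite set" and E :: "'v set set"
  assumes "complete_graph V E"
  shows "circuit_diameter (forest_polytope V E) (circuits E (forest_rows V E) (forest_matrix E)) \<le> 7"
proof -
  note G = assms
  let ?P = "forest_polytope V E" and ?C = "circuits E (forest_rows V E) (forest_matrix E)"
  have "circuit_dist ?P ?C u v \<le> 7" if u: "u extreme_point_of ?P" and v: "v extreme_point_of ?P" for u v
  proof -
    obtain F F' where F: "F \<subseteq> E" "u = char_vec F" and F': "F' \<subseteq> E" "v = char_vec F'"
      using extreme_point_is_char_vec[OF G u] extreme_point_is_char_vec[OF G v] by blast
    have forests: "forest V E F" "forest V E F'"
      using u v F F' by (auto simp: forest_def extreme_point_of_def)
    have "(F, F') \<in> ((exchange V E)\<^sup>=) ^^ 7"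
    proof (cases "2 \<le> card V")
      case True
      then show ?thesis by (rule exchange_diameter[OF G forests])
    next
      \<comment> \<open>Fewer than two vertices carry no edge, so both forests are empty.\<close>
      case False
      have "E = {}"
      proof (rule ccontr)
        assume "E \<noteq> {}"
        then obtain e where "e \<in> E" by blast
        then have "e \<subseteq> V" "card e = 2" using complete_graph_edge[OF G] by blast+
        then show False using False card_mono[of V e] by simp
      qed
      with F F' have "F = F'" by blast
      then show ?thesis unfolding relpow_fun_conv by (intro exI[of _ "\<lambda>_. F'"]) simp
    qed
    from relpow_reflcl_le[OF this] obtain k where k: "k \<le> 7" "(F, F') \<in> exchange V E ^^ k"
      by blast
    have "circuit_dist ?P ?C u v \<le> enat k"
      using circuit_dist_le[OF G _ k(2)] u F F' by simp
    also have "enat k \<le> 7" using k(1) by (simp add: numeral_eq_enat)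
    finally show ?thesis .
  qed
  then show ?thesis unfolding circuit_diameter_def by (intro SUP_least) auto
qed

end
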